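(* Let $X$ be a complex Banach space with a normalized unconditional Schauder basis $\{e_j\}$ with unconditional basis constant $1$. If $X^*$ is uniformly complex convex, then $X^*$ admits a uniformly simultaneously continuous retraction.
   Context: $B_{X^*}$ is the closed unit ball of $X^*$. $X^*$ is said to admit a uniformly simultaneously continuous retraction if there is a map $r:X^*\to B_{X^*}$ which is the identity on $B_{X^*}$, is weak-$*$ continuous (weak-$*$ to weak-$*$), and is uniformly continuous in the norm. A complex Banach space $Z$ is uniformly complex convex if for every $\varepsilon>0$ $$\inf\Big\{\sup_{0\le\theta\le 2\pi}\|x+e^{i\theta}y\|-1 : x,y\in Z,\ \|x\|=1,\ \|y\|\ge\varepsilon\Big\}>0.$$ *)

theory Defs
  imports "HOL-Analysis.Analysis"
begin

section \<open>Complex normed and complex Banach spaces\<close>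

class scaleC =
  fixes scaleC :: "complex \<Rightarrow> 'a \<Rightarrow> 'a"  (infixr "*\<^sub>C" 75)

class complex_normed_vector = real_normed_vector + scaleC +
  assumes scaleC_add_right: "c *\<^sub>C (x + y) = c *\<^sub>C x + c *\<^sub>C y"
    and scaleC_add_left: "(c + d) *\<^sub>C x = c *\<^sub>C x + d *\<^sub>C x"
    and scaleC_scaleC: "c *\<^sub>C d *\<^sub>C x = (c * d) *\<^sub>C x"
    and scaleC_of_real: "complex_of_real t *\<^sub>C x = t *\<^sub>R x"
    and norm_scaleC: "norm (c *\<^sub>C x) = cmod c * norm x"

class complex_banach = complex_normed_vector + banach

instantiation complex :: complex_banach
begin

definition scaleC_complex :: "complex \<Rightarrow> complex \<Rightarrow> complex"
  where "scaleC_complex c x = c * x"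

instance
  by standard
    (simp_all add: scaleC_complex_def algebra_simps norm_mult scaleR_conv_of_real)

end


section \<open>The dual space\<close>

text \<open>The elements of the dual are the bounded real-linear maps into the complex numbers that
  also commute with complex scalars; the norm is the operator norm, inherited from
  \<^typ>\<open>'a \<Rightarrow>\<^sub>L complex\<close>.\<close>

typedef (overloaded) 'a cdual =
  "{f :: 'a::complex_normed_vector \<Rightarrow>\<^sub>L complex. \<forall>c x. blinfun_apply f (c *\<^sub>C x) = c * blinfun_apply f x}"
  morphisms blinfun_of_cdual Abs_cdual
  by (rule exI[of _ 0]) simp

setup_lifting type_definition_cdual

lift_definition cdual_apply :: "'a::complex_normed_vector cdual \<Rightarrow> 'a \<Rightarrow> complex"
  is blinfun_apply .

instantiation cdual :: (complex_normed_vector) complex_normed_vector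
begin

lift_definition norm_cdual :: "'a cdual \<Rightarrow> real" is norm .

lift_definition zero_cdual :: "'a cdual" is 0 by simp

lift_definition plus_cdual :: "'a cdual \<Rightarrow> 'a cdual \<Rightarrow> 'a cdual" is "(+)"
  by (simp add: blinfun.bilinear_simps algebra_simps)

lift_definition minus_cdual :: "'a cdual \<Rightarrow> 'a cdual \<Rightarrow> 'a cdual" is "(-)"
  by (simp add: blinfun.bilinear_simps algebra_simps)

lift_definition uminus_cdual :: "'a cdual \<Rightarrow> 'a cdual" is uminus
  by (simp add: blinfun.bilinear_simps)

lift_definition scaleR_cdual :: "real \<Rightarrow> 'a cdual \<Rightarrow> 'a cdual" is scaleR
  by (simp add: blinfun.bilinear_simps)

lift_definition scaleC_cdual :: "complex \<Rightarrow> 'a cdual \<Rightarrow> 'a cdual"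
  is "\<lambda>c f. blinfun_compose (Blinfun (\<lambda>z. c * z)) f"
  by (simp add: bounded_linear_Blinfun_apply bounded_linear_mult_right)

definition dist_cdual :: "'a cdual \<Rightarrow> 'a cdual \<Rightarrow> real"
  where "dist_cdual f g = norm (f - g)"

definition uniformity_cdual :: "('a cdual \<times> 'a cdual) filter"
  where "uniformity_cdual = (INF e\<in>{0 <..}. principal {(f, g). dist f g < e})"

definition open_cdual :: "'a cdual set \<Rightarrow> bool"
  where "open_cdual S = (\<forall>f\<in>S. \<forall>\<^sub>F (f', g) in uniformity. f' = f \<longrightarrow> g \<in> S)"

definition sgn_cdual :: "'a cdual \<Rightarrow> 'a cdual"
  where "sgn_cdual f = inverse (norm f) *\<^sub>R f"

instance
proof
  fix f g h :: "'a cdual" and s t :: real and c d :: complex and S :: "'a cdual set"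
  note mult = bounded_linear_Blinfun_apply[OF bounded_linear_mult_right]
  show "f + g + h = f + (g + h)" "f + g = g + f" "0 + f = f" "- f + f = 0" "f - g = f + - g"
    by (transfer; simp)+
  show "t *\<^sub>R (f + g) = t *\<^sub>R f + t *\<^sub>R g" "(s + t) *\<^sub>R f = s *\<^sub>R f + t *\<^sub>R f"
    "s *\<^sub>R t *\<^sub>R f = (s * t) *\<^sub>R f" "1 *\<^sub>R f = f"
    by (transfer; simp add: algebra_simps)+
  show "norm f = 0 \<longleftrightarrow> f = 0" "norm (f + g) \<le> norm f + norm g"
    "norm (t *\<^sub>R f) = \<bar>t\<bar> * norm f"
    by (transfer; simp add: norm_triangle_ineq)+
  show "dist f g = norm (f - g)" by (rule dist_cdual_def)
  show "sgn f = inverse (norm f) *\<^sub>R f" by (rule sgn_cdual_def)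
  show "(uniformity :: ('a cdual \<times> 'a cdual) filter) =
      (INF e\<in>{0 <..}. principal {(f, g). dist f g < e})"
    by (rule uniformity_cdual_def)
  show "open S \<longleftrightarrow> (\<forall>f\<in>S. \<forall>\<^sub>F (f', g) in uniformity. f' = f \<longrightarrow> g \<in> S)"
    by (rule open_cdual_def)
  show "c *\<^sub>C (f + g) = c *\<^sub>C f + c *\<^sub>C g" "(c + d) *\<^sub>C f = c *\<^sub>C f + d *\<^sub>C f"
    "c *\<^sub>C d *\<^sub>C f = (c * d) *\<^sub>C f" "complex_of_real t *\<^sub>C f = t *\<^sub>R f"
    by (transfer; rule blinfun_eqI;
        simp add: mult blinfun.bilinear_simps algebra_simps scaleR_conv_of_real)+
  show "norm (c *\<^sub>C f) = cmod c * norm f"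
  proof transfer
    fix c :: complex and f :: "'a \<Rightarrow>\<^sub>L complex"
    have "norm (Blinfun ((*) c) o\<^sub>L f) = onorm (\<lambda>x. c * blinfun_apply f x)"
      by (simp add: norm_blinfun.rep_eq blinfun_compose.rep_eq mult o_def)
    also have "\<dots> = onorm (\<lambda>x. cmod c *\<^sub>R blinfun_apply f x)"
      by (simp add: onorm_def norm_mult)
    also have "\<dots> = cmod c * norm f"
      by (subst onorm_scaleR) (simp_all add: norm_blinfun.rep_eq blinfun.bounded_linear_right)
    finally show "norm (Blinfun ((*) c) o\<^sub>L f) = cmod c * norm f" .
  qed
qed

end

lemma cdual_apply_scaleC_left: "cdual_apply (c *\<^sub>C f) x = c * cdual_apply f x"
  by transfer (simp add: bounded_linear_Blinfun_apply bounded_linear_mult_right)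

lemma norm_cdual_eq: "norm f = onorm (cdual_apply f)"
  by transfer (rule norm_blinfun.rep_eq)

instance cdual :: (complex_normed_vector) complex_banach
proof
  fix X :: "nat \<Rightarrow> 'a cdual"
  assume X: "Cauchy X"
  have dist_eq: "dist f g = dist (blinfun_of_cdual f) (blinfun_of_cdual g)" for f g :: "'a cdual"
    by (simp add: dist_norm norm_cdual.rep_eq minus_cdual.rep_eq)
  have "Cauchy (\<lambda>n. blinfun_of_cdual (X n))"
    using X by (simp add: Cauchy_def dist_eq)
  then obtain F where F: "(\<lambda>n. blinfun_of_cdual (X n)) \<longlonglongrightarrow> F"
    by (auto simp: Cauchy_convergent_iff convergent_def)
  have "blinfun_apply F (c *\<^sub>C x) = c * blinfun_apply F x" for c x
  proof (rule LIMSEQ_unique)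
    have *: "(\<lambda>n. blinfun_apply (blinfun_of_cdual (X n)) y) \<longlonglongrightarrow> blinfun_apply F y" for y
      by (intro blinfun.tendsto F tendsto_const)
    show "(\<lambda>n. blinfun_apply (blinfun_of_cdual (X n)) (c *\<^sub>C x)) \<longlonglongrightarrow> blinfun_apply F (c *\<^sub>C x)"
      by (rule *)
    show "(\<lambda>n. blinfun_apply (blinfun_of_cdual (X n)) (c *\<^sub>C x)) \<longlonglongrightarrow> c * blinfun_apply F x"
      using tendsto_mult_left[OF *[of x], of c]
      by (simp add: blinfun_of_cdual[simplified])
  qed
  then have "blinfun_of_cdual (Abs_cdual F) = F"
    by (simp add: Abs_cdual_inverse)
  then have "X \<longlonglongrightarrow> Abs_cdual F"
    using F by (simp add: lim_sequentially dist_eq)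
  then show "convergent X"
    by (auto simp: convergent_def)
qed

text \<open>The initial topology for the evaluations at the points of \<^typ>\<open>'a\<close>.\<close>

definition weak_star :: "'a::complex_normed_vector cdual topology"
  where "weak_star = pullback_topology UNIV cdual_apply (product_topology (\<lambda>_. euclidean) UNIV)"


section \<open>Schauder bases\<close>

definition schauder_basis :: "(nat \<Rightarrow> 'a::complex_normed_vector) \<Rightarrow> bool"
  where "schauder_basis e \<longleftrightarrow> (\<forall>x. \<exists>!a. (\<lambda>j. a j *\<^sub>C e j) sums x)"

text \<open>For a Schauder basis, the sequence \<open>a\<close> below runs through the coefficient sequences of
  the vectors of the space, so the condition says that every basis expansion converges
  unconditionally.\<close>

definition unconditional_schauder_basis :: "(nat \<Rightarrow> 'a::complex_normed_vector) \<Rightarrow> bool"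
  where "unconditional_schauder_basis e \<longleftrightarrow> schauder_basis e \<and>
    (\<forall>a. summable (\<lambda>j. a j *\<^sub>C e j) \<longrightarrow>
      (\<forall>\<pi>. bij \<pi> \<longrightarrow> summable (\<lambda>j. a (\<pi> j) *\<^sub>C e (\<pi> j))))"

text \<open>The least \<open>K\<close> for which the domination inequality holds; the scalars are complex. The
  infimum is taken in \<^typ>\<open>ereal\<close> so that it is infinite if there is no such \<open>K\<close>.\<close>

definition unconditional_basis_constant :: "(nat \<Rightarrow> 'a::complex_normed_vector) \<Rightarrow> ereal"
  where "unconditional_basis_constant e =
    Inf {ereal K | K. \<forall>(N::nat) (a :: nat \<Rightarrow> complex) b. (\<forall>j<N. cmod (a j) \<le> cmod (b j)) \<longrightarrow>
      norm (\<Sum>j<N. a j *\<^sub>C e j) \<le> K * norm (\<Sum>j<N. b j *\<^sub>C e j)}"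


section \<open>Uniform complex convexity and retractions onto the dual ball\<close>

text \<open>The outer infimum is taken in \<^typ>\<open>ereal\<close>, where the empty infimum (trivial space) is
  infinite. The inner supremum is over a bounded nonempty set of reals.\<close>

definition uniformly_complex_convex :: "'z::complex_banach itself \<Rightarrow> bool"
  where "uniformly_complex_convex (_ :: 'z itself) \<longleftrightarrow>
    (\<forall>\<epsilon>>0. (INF (x, y)\<in>{(x :: 'z, y :: 'z). norm x = 1 \<and> norm y \<ge> \<epsilon>}.
      ereal ((SUP \<theta>\<in>{0..2 * pi}. norm (x + cis \<theta> *\<^sub>C y)) - 1)) > 0)"

definition dual_admits_uniformly_simultaneously_continuous_retraction ::
    "'x::complex_banach itself \<Rightarrow> bool"
  where "dual_admits_uniformly_simultaneously_continuous_retraction (_ :: 'x itself) \<longleftrightarrow>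
    (\<exists>r :: 'x cdual \<Rightarrow> 'x cdual.
      range r \<subseteq> cball 0 1 \<and>
      (\<forall>f\<in>cball 0 1. r f = f) \<and>
      continuous_map weak_star (subtopology weak_star (cball 0 1)) r \<and>
      uniformly_continuous_on UNIV r)"

end

theory Submission
  imports Defs
begin

text \<open>A functional \<open>f\<close> is determined by its coordinates \<open>f (e j)\<close>, and since the basis has constant
  one, the dual norm depends monotonically on the moduli of these coordinates
  (\<open>dual_norm_mono\<close>). The retraction reads the coordinates of \<open>f\<close> in order and stops as soon as the
  norm reaches one. To make this continuous, the last coordinate is admitted gradually: the
  initial part of length \<open>s\<close>, for a real \<open>s \<ge> 0\<close>, keeps the first \<open>\<lfloor>s\<rfloor>\<close> coordinates, multiplies the
  next one by the fractional part of \<open>s\<close> and deletes the others. If \<open>norm f > 1\<close>, the norms of the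
  initial parts grow continuously from \<open>0\<close> to a value above \<open>1\<close>, so some initial part has norm
  one; this is the image of \<open>f\<close>. Functionals in the unit ball stay fixed.

  Complex convexity controls how far the image can move. If \<open>h\<close> arises from \<open>w\<close> by multiplying the
  coordinates by numbers in \<open>[0, 1]\<close>, then \<open>h + cis \<theta> *\<^sub>C (w - h)\<close> has coordinates no larger in modulus
  than those of \<open>w\<close>, so the supremum over \<open>\<theta>\<close> in the definition of complex convexity is at most
  \<open>norm w\<close>. Therefore, if \<open>norm w \<le> 1\<close> and \<open>norm h\<close> is close to one, then \<open>w - h\<close> is small
  (\<open>uniform_monotonicity\<close>). Now let \<open>f\<close> and \<open>g\<close> be close, and let the one which is cut off earlier be
  \<open>f\<close>, at length \<open>s\<close>. The initial part of \<open>g\<close> of length \<open>s\<close> is close to that of \<open>f\<close>, hence almost of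
  norm one, hence close to the image of \<open>g\<close>, which extends it within the unit ball. This is the
  uniform continuity (\<open>cutoffs_close\<close>); with \<open>f = g\<close> it also shows that the image is unique.

  For weak-star continuity, coordinate \<open>n\<close> of the image depends only on the first \<open>n + 1\<close>
  coordinates of \<open>f\<close> (\<open>cutoff_local\<close>), and passing to these is continuous from the weak-star
  topology to the norm topology, as finitely many evaluations are involved. So the value of the
  image at each basis vector is weak-star continuous. As the images are bounded by one, its value
  at any other vector is a uniform limit of such functions.\<close>

section \<open>Dual functionals\<close>

lemma bounded_linear_scaleC_left: "bounded_linear (\<lambda>c. c *\<^sub>C (v :: 'a::complex_normed_vector))"
proof (rule bounded_linear_intro)
  fix c d :: complex and t :: real
  show "(c + d) *\<^sub>C v = c *\<^sub>C v + d *\<^sub>C v" by (rule scaleC_add_left)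
  show "(t *\<^sub>R c) *\<^sub>C v = t *\<^sub>R c *\<^sub>C v"
    by (simp add: scaleR_conv_of_real flip: scaleC_scaleC scaleC_of_real)
  show "norm (c *\<^sub>C v) \<le> norm c * norm v" by (simp add: norm_scaleC)
qed

lemma scaleC_zero_left [simp]: "0 *\<^sub>C (v :: 'a::complex_normed_vector) = 0"
  using bounded_linear_scaleC_left by (rule linear_simps(3))

lemma scaleC_one: "1 *\<^sub>C (v :: 'a::complex_normed_vector) = v"
  using scaleC_of_real[of 1 v] by simp

lemma bounded_linear_scaleC_right: "bounded_linear (\<lambda>v. c *\<^sub>C (v :: 'a::complex_normed_vector))"
proof (rule bounded_linear_intro)
  fix v w :: 'a and t :: real
  show "c *\<^sub>C (v + w) = c *\<^sub>C v + c *\<^sub>C w" by (rule scaleC_add_right)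
  show "c *\<^sub>C t *\<^sub>R v = t *\<^sub>R c *\<^sub>C v"
    by (simp add: scaleC_scaleC mult.commute flip: scaleC_of_real)
  show "norm (c *\<^sub>C v) \<le> norm v * cmod c" by (simp add: norm_scaleC)
qed

lemma bounded_linear_cdual_apply: "bounded_linear (cdual_apply f)"
  by transfer (rule blinfun.bounded_linear_right)

lemma cdual_apply_scaleC: "cdual_apply f (c *\<^sub>C x) = c * cdual_apply f x"
  by transfer simp

lemmas cdual_apply_simps = linear_simps[OF bounded_linear_cdual_apply]
  linear_sum[OF bounded_linear.linear[OF bounded_linear_cdual_apply]] cdual_apply_scaleC

lemma cdual_apply_le: "cmod (cdual_apply f x) \<le> norm f * norm x"
  by transfer (rule norm_blinfun)

lemma cdual_norm_le: "(\<And>x. cmod (cdual_apply f x) \<le> B * norm x) \<Longrightarrow> 0 \<le> B \<Longrightarrow> norm f \<le> B"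
  by transfer (rule norm_blinfun_bound)

lemma cdual_apply_plus_left: "cdual_apply (f + g) x = cdual_apply f x + cdual_apply g x"
  by transfer (simp add: blinfun.bilinear_simps)

lemma bounded_linear_cdual_eval: "bounded_linear (\<lambda>f. cdual_apply f x)"
proof (rule bounded_linear_intro)
  fix f g :: "'a cdual" and t :: real
  show "cdual_apply (f + g) x = cdual_apply f x + cdual_apply g x"
    by (rule cdual_apply_plus_left)
  show "cdual_apply (t *\<^sub>R f) x = t *\<^sub>R cdual_apply f x"
    by transfer (simp add: blinfun.bilinear_simps)
  show "norm (cdual_apply f x) \<le> norm f * norm x" by (rule cdual_apply_le)
qed

lemmas cdual_eval_simps = linear_simps[OF bounded_linear_cdual_eval]
  linear_sum[OF bounded_linear.linear[OF bounded_linear_cdual_eval]] cdual_apply_scaleC_left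

lemma ex_cdual:
  assumes "\<And>x y. \<phi> (x + y) = \<phi> x + \<phi> y" "\<And>c x. \<phi> (c *\<^sub>C x) = c * \<phi> x"
    and "\<And>x. cmod (\<phi> x) \<le> norm x * K"
  shows "\<exists>f. cdual_apply f = \<phi>"
proof -
  have "bounded_linear \<phi>"
  proof (rule bounded_linear_intro)
    show "\<phi> (t *\<^sub>R x) = t *\<^sub>R \<phi> x" for t x
      using assms(2)[of "complex_of_real t" x] by (simp add: scaleC_of_real scaleR_conv_of_real)
  qed (rule assms)+
  then have "blinfun_apply (Blinfun \<phi>) = \<phi>" by (rule bounded_linear_Blinfun_apply)
  then have "cdual_apply (Abs_cdual (Blinfun \<phi>)) = \<phi>"
    by (simp add: cdual_apply.rep_eq Abs_cdual_inverse assms(2))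
  then show ?thesis by blast
qed


section \<open>Coordinates with respect to a basis of constant one\<close>

locale one_unconditional_basis =
  fixes e :: "nat \<Rightarrow> 'a::complex_banach"
  assumes schauder: "schauder_basis e"
    and norm_basis: "norm (e j) = 1"
    and domination: "(\<And>j. j < N \<Longrightarrow> cmod (a j) \<le> cmod (b j)) \<Longrightarrow>
      norm (\<Sum>j<N. a j *\<^sub>C e j) \<le> norm (\<Sum>j<N. b j *\<^sub>C e j)"
begin

definition coord :: "'a \<Rightarrow> nat \<Rightarrow> complex"
  where "coord x = (THE a. (\<lambda>j. a j *\<^sub>C e j) sums x)"

lemma coord_sums: "(\<lambda>j. coord x j *\<^sub>C e j) sums x"
proof -
  have "\<exists>!a. (\<lambda>j. a j *\<^sub>C e j) sums x"
    using schauder by (auto simp only: schauder_basis_def)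
  then show ?thesis unfolding coord_def by (rule theI')
qed

lemma coord_unique: "(\<lambda>j. a j *\<^sub>C e j) sums x \<Longrightarrow> coord x = a"
  using schauder coord_sums[of x] unfolding schauder_basis_def by blast

lemma coord_add: "coord (x + y) j = coord x j + coord y j"
proof -
  have "(\<lambda>j. (coord x j + coord y j) *\<^sub>C e j) sums (x + y)"
    unfolding scaleC_add_left by (intro sums_add coord_sums)
  from coord_unique[OF this] show ?thesis by simp
qed

lemma coord_scaleC: "coord (c *\<^sub>C x) j = c * coord x j"
proof -
  have "(\<lambda>j. (c * coord x j) *\<^sub>C e j) sums (c *\<^sub>C x)"
    unfolding scaleC_scaleC[symmetric]
    by (intro bounded_linear.sums[OF bounded_linear_scaleC_right] coord_sums)
  from coord_unique[OF this] show ?thesis by simp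
qed

lemma coord_basis: "coord (e k) j = (if j = k then 1 else 0)"
proof -
  have "(\<lambda>j. (if j = k then 1 else 0) *\<^sub>C e j) = (\<lambda>j. if j = k then e j else 0)"
    by (auto simp: scaleC_one)
  then have "(\<lambda>j. (if j = k then 1 else 0) *\<^sub>C e j) sums e k"
    using sums_single[of k e] by simp
  from coord_unique[OF this] show ?thesis by simp
qed

text \<open>By domination, deleting coordinates decreases the norm of the longer partial sums, which tend
  to \<open>x\<close>.\<close>

lemma norm_partial_sum_le: "norm (\<Sum>j<N. coord x j *\<^sub>C e j) \<le> norm x"
proof (rule LIMSEQ_le_const)
  show "(\<lambda>n. norm (\<Sum>j<n. coord x j *\<^sub>C e j)) \<longlonglongrightarrow> norm x"
    using coord_sums[of x] unfolding sums_def by (rule tendsto_norm)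
  have "norm (\<Sum>j<N. coord x j *\<^sub>C e j) \<le> norm (\<Sum>j<n. coord x j *\<^sub>C e j)" if "N \<le> n" for n
  proof -
    have "(\<Sum>j<N. coord x j *\<^sub>C e j) = (\<Sum>j<n. (if j < N then coord x j else 0) *\<^sub>C e j)"
      using that by (intro sum.mono_neutral_cong_left) auto
    also have "norm \<dots> \<le> norm (\<Sum>j<n. coord x j *\<^sub>C e j)" by (rule domination) simp
    finally show ?thesis .
  qed
  then show "\<exists>M. \<forall>n\<ge>M. norm (\<Sum>j<N. coord x j *\<^sub>C e j) \<le> norm (\<Sum>j<n. coord x j *\<^sub>C e j)"
    by blast
qed

lemma cmod_coord_le: "cmod (coord x k) \<le> norm x"
proof -
  have "(\<Sum>j<Suc k. (if j = k then coord x k else 0) *\<^sub>C e j) = coord x k *\<^sub>C e k"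
    by simp
  moreover have "norm (\<Sum>j<Suc k. (if j = k then coord x k else 0) *\<^sub>C e j)
      \<le> norm (\<Sum>j<Suc k. coord x j *\<^sub>C e j)"
    by (rule domination) simp
  ultimately show ?thesis
    using norm_partial_sum_le[of x "Suc k"] by (simp add: norm_scaleC norm_basis)
qed

section \<open>Monotonicity of the dual norm\<close>

lemma dual_eqI:
  assumes "\<And>j. cdual_apply f (e j) = cdual_apply g (e j)" shows "f = g"
proof -
  have "cdual_apply f x = cdual_apply g x" for x
  proof -
    have "(\<lambda>j. cdual_apply h (coord x j *\<^sub>C e j)) sums cdual_apply h x" for h
      using bounded_linear.sums[OF bounded_linear_cdual_apply coord_sums] .
    from this[of f] this[of g] show ?thesis
      by (auto simp: cdual_apply_scaleC assms intro: sums_unique2)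
  qed
  then show ?thesis by transfer (auto intro: blinfun_eqI)
qed

text \<open>The coordinates of \<open>h\<close> are those of \<open>k\<close> times numbers \<open>c j\<close> of modulus at most one, and these
  multipliers can be moved to the vector: on a finite combination, \<open>h\<close> has the value of \<open>k\<close> at the
  combination with coefficients multiplied by \<open>c j\<close>, whose norm is no larger. So the dual basis
  inherits the constant one.\<close>

lemma dual_norm_mono:
  assumes "\<And>j. cmod (cdual_apply h (e j)) \<le> cmod (cdual_apply k (e j))"
  shows "norm h \<le> norm k"
proof (rule cdual_norm_le)
  fix x
  define c where "c j = cdual_apply h (e j) / cdual_apply k (e j)" for j
  \<comment> \<open>Where \<open>k\<close> vanishes so does \<open>h\<close>, and the value \<open>x / 0 = 0\<close> is a valid multiplier.\<close>
  have c: "cmod (c j) \<le> 1" "cdual_apply h (e j) = c j * cdual_apply k (e j)" for j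
    using assms[of j] by (auto simp: c_def norm_divide divide_simps)
  have "(\<lambda>N. cmod (cdual_apply h (\<Sum>j<N. coord x j *\<^sub>C e j))) \<longlonglongrightarrow> cmod (cdual_apply h x)"
    using coord_sums[of x] unfolding sums_def
    by (intro tendsto_norm bounded_linear.tendsto[OF bounded_linear_cdual_apply])
  moreover have "cmod (cdual_apply h (\<Sum>j<N. coord x j *\<^sub>C e j)) \<le> norm k * norm x" for N
  proof -
    have "cdual_apply h (\<Sum>j<N. coord x j *\<^sub>C e j) = cdual_apply k (\<Sum>j<N. (c j * coord x j) *\<^sub>C e j)"
      by (simp add: cdual_apply_simps c(2) mult_ac)
    also have "cmod \<dots> \<le> norm k * norm (\<Sum>j<N. (c j * coord x j) *\<^sub>C e j)"
      by (rule cdual_apply_le)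
    also have "\<dots> \<le> norm k * norm (\<Sum>j<N. coord x j *\<^sub>C e j)"
      by (intro mult_left_mono domination) (auto simp: norm_mult c(1) mult_left_le_one_le)
    also have "\<dots> \<le> norm k * norm x"
      by (intro mult_left_mono norm_partial_sum_le) auto
    finally show ?thesis .
  qed
  ultimately show "cmod (cdual_apply h x) \<le> norm k * norm x"
    by (intro LIMSEQ_le_const2) auto
qed simp

definition coord_functional :: "nat \<Rightarrow> 'a cdual"
  where "coord_functional j = (SOME f. cdual_apply f = (\<lambda>x. coord x j))"

lemma coord_functional_basis:
  "cdual_apply (coord_functional j) (e k) = (if j = k then 1 else 0)"
proof -
  have "\<exists>f. cdual_apply f = (\<lambda>x. coord x j)"
    using cmod_coord_le by (intro ex_cdual[where K = 1]) (simp_all add: coord_add coord_scaleC)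
  then have "cdual_apply (coord_functional j) = (\<lambda>x. coord x j)"
    unfolding coord_functional_def by (rule someI_ex)
  then show ?thesis by (simp add: coord_basis)
qed

section \<open>Initial parts of real length\<close>

definition ramp :: "real \<Rightarrow> nat \<Rightarrow> real"
  where "ramp s j = max 0 (min 1 (s - real j))"

text \<open>The sum runs over the support of the ramp, so that an initial part is a finite combination. This
  makes it depend continuously on the length in norm, and on \<open>f\<close> from the weak-star to the norm
  topology.\<close>

definition initial_part :: "real \<Rightarrow> 'a cdual \<Rightarrow> 'a cdual"
  where "initial_part s f =
    (\<Sum>j<nat \<lceil>s\<rceil>. (of_real (ramp s j) * cdual_apply f (e j)) *\<^sub>C coord_functional j)"

text \<open>The functionals \<open>coord_functional j\<close> are biorthogonal to the basis, so finite combinations of them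
  have their coefficients as coordinates.\<close>

lemma finite_sum_basis:
  "cdual_apply (\<Sum>j<N. c j *\<^sub>C coord_functional j) (e k) = (if k < N then c k else 0)"
  by (simp add: cdual_eval_simps coord_functional_basis if_distrib[of "(*) _"] sum.delta
      cong: if_cong)

lemma initial_part_basis:
  "cdual_apply (initial_part s f) (e k) = of_real (ramp s k) * cdual_apply f (e k)"
proof -
  have "ramp s k = 0" if "\<not> k < nat \<lceil>s\<rceil>"
    using that by (simp add: ramp_def) linarith
  then show ?thesis by (simp add: initial_part_def finite_sum_basis)
qed

text \<open>A summation range that does not depend on \<open>s\<close> exposes continuity in \<open>s\<close>.\<close>

lemma initial_part_eq_sum:
  assumes "s \<le> real N"
  shows "initial_part s f =
    (\<Sum>j<N. (of_real (ramp s j) * cdual_apply f (e j)) *\<^sub>C coord_functional j)"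
  using assms by (intro dual_eqI) (auto simp: initial_part_basis finite_sum_basis ramp_def)

lemma initial_part_diff_le: "norm (initial_part s f - initial_part s g) \<le> norm (f - g)"
proof (rule dual_norm_mono)
  fix j
  have "cdual_apply (initial_part s f - initial_part s g) (e j)
      = of_real (ramp s j) * cdual_apply (f - g) (e j)"
    by (simp add: cdual_eval_simps initial_part_basis algebra_simps)
  then show "cmod (cdual_apply (initial_part s f - initial_part s g) (e j))
      \<le> cmod (cdual_apply (f - g) (e j))"
    by (simp add: norm_mult ramp_def mult_left_le_one_le)
qed

lemma continuous_on_norm_initial_part: "continuous_on {..real N} (\<lambda>s. norm (initial_part s f))"
proof -
  have "continuous_on {..real N}
      (\<lambda>s. norm (\<Sum>j<N. (of_real (ramp s j) * cdual_apply f (e j)) *\<^sub>C coord_functional j))"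
    unfolding ramp_def
    by (intro continuous_intros bounded_linear.continuous_on[OF bounded_linear_scaleC_left])
  then show ?thesis
    by (rule continuous_on_eq) (simp add: initial_part_eq_sum)
qed

text \<open>On the span of the first \<open>N\<close> basis vectors, \<open>f\<close> agrees with its initial part of length \<open>N\<close>, and
  the partial sums of \<open>x\<close> are no longer than \<open>x\<close>.\<close>

lemma norm_le_if_initial_parts_le:
  assumes "\<And>N. norm (initial_part (real N) f) \<le> B" shows "norm f \<le> B"
proof (rule cdual_norm_le)
  show "0 \<le> B" using norm_ge_zero assms by (rule order_trans)
  fix x
  have "(\<lambda>N. cmod (cdual_apply f (\<Sum>j<N. coord x j *\<^sub>C e j))) \<longlonglongrightarrow> cmod (cdual_apply f x)"
    using coord_sums[of x] unfolding sums_def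
    by (intro tendsto_norm bounded_linear.tendsto[OF bounded_linear_cdual_apply])
  moreover have "cmod (cdual_apply f (\<Sum>j<N. coord x j *\<^sub>C e j)) \<le> B * norm x" for N
  proof -
    have "ramp (real N) j = 1" if "j < N" for j
      using that by (simp add: ramp_def)
    then have "cdual_apply f (\<Sum>j<N. coord x j *\<^sub>C e j)
        = cdual_apply (initial_part (real N) f) (\<Sum>j<N. coord x j *\<^sub>C e j)"
      by (simp add: cdual_apply_simps initial_part_basis)
    also have "cmod \<dots> \<le> norm (initial_part (real N) f) * norm (\<Sum>j<N. coord x j *\<^sub>C e j)"
      by (rule cdual_apply_le)
    also have "\<dots> \<le> B * norm x"
      by (intro mult_mono assms norm_partial_sum_le \<open>0 \<le> B\<close>) auto
    finally show ?thesis .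
  qed
  ultimately show "cmod (cdual_apply f x) \<le> B * norm x"
    by (intro LIMSEQ_le_const2) auto
qed

text \<open>The factors may differ between coordinates. A shorter initial part is related in this way to a
  longer one and to the whole functional, so this relation treats both kinds of image of the
  retraction alike.\<close>

definition damping :: "'a cdual \<Rightarrow> 'a cdual \<Rightarrow> bool"
  where "damping h w \<longleftrightarrow>
    (\<forall>j. \<exists>t\<in>{0..1}. cdual_apply h (e j) = complex_of_real t * cdual_apply w (e j))"

lemma damping_initial_part: "damping (initial_part s f) f"
  unfolding damping_def initial_part_basis
proof
  fix j
  show "\<exists>t\<in>{0..1}. of_real (ramp s j) * cdual_apply f (e j) = of_real t * cdual_apply f (e j)"
    by (intro bexI[of _ "ramp s j"] refl) (simp add: ramp_def)
qed

lemma damping_initial_parts: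
  assumes "s \<le> t" shows "damping (initial_part s f) (initial_part t f)"
  unfolding damping_def
proof
  fix j
  have "0 \<le> ramp s j" "ramp s j \<le> ramp t j"
    using assms by (auto simp: ramp_def)
  then show "\<exists>u\<in>{0..1}. cdual_apply (initial_part s f) (e j)
      = complex_of_real u * cdual_apply (initial_part t f) (e j)"
    by (intro bexI[of _ "ramp s j / ramp t j"]) (auto simp: initial_part_basis divide_simps)
qed

lemma damping_norm_le:
  assumes "damping h w" shows "norm h \<le> norm w"
proof (rule dual_norm_mono)
  fix j
  obtain t where "0 \<le> t" "t \<le> 1" "cdual_apply h (e j) = complex_of_real t * cdual_apply w (e j)"
    using assms by (fastforce simp: damping_def)
  then show "cmod (cdual_apply h (e j)) \<le> cmod (cdual_apply w (e j))"
    by (simp add: norm_mult mult_left_le_one_le)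
qed

text \<open>In each coordinate \<open>h\<close> and \<open>w - h\<close> are nonnegative multiples of the same complex number, so
  rotating one of them against the other cannot increase the modulus of the sum.\<close>

lemma damping_rotation_le:
  assumes "damping h w" shows "norm (h + cis \<theta> *\<^sub>C (w - h)) \<le> norm w"
proof (rule dual_norm_mono)
  fix j
  obtain t where t: "0 \<le> t" "t \<le> 1" "cdual_apply h (e j) = complex_of_real t * cdual_apply w (e j)"
    using assms by (fastforce simp: damping_def)
  have "cdual_apply (h + cis \<theta> *\<^sub>C (w - h)) (e j)
      = (of_real t + cis \<theta> * of_real (1 - t)) * cdual_apply w (e j)"
    by (simp add: cdual_eval_simps t(3) algebra_simps)
  moreover have "cmod (of_real t + cis \<theta> * of_real (1 - t)) \<le> t + (1 - t)"
    by (rule order_trans[OF norm_triangle_ineq])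
      (use t in \<open>simp add: norm_mult del: of_real_diff\<close>)
  ultimately show "cmod (cdual_apply (h + cis \<theta> *\<^sub>C (w - h)) (e j)) \<le> cmod (cdual_apply w (e j))"
    by (simp add: norm_mult mult_left_le_one_le)
qed

end


section \<open>The retraction\<close>

locale complex_convex_dual_basis = one_unconditional_basis e
  for e :: "nat \<Rightarrow> 'a::complex_banach" +
  assumes complex_convex: "uniformly_complex_convex TYPE('a cdual)"
begin

text \<open>Complex convexity is applied to \<open>h\<close> and \<open>w - h\<close>, divided by \<open>norm h\<close>. Were \<open>w - h\<close> large, the
  norms of the rotated sums would have a supremum above \<open>1 + \<eta>\<close>; but they are at most
  \<open>norm w / norm h\<close>.\<close>

lemma uniform_monotonicity:
  assumes "\<epsilon> > 0"
  obtains \<delta> where "\<delta> > 0"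
    "\<And>h w. damping h w \<Longrightarrow> norm w \<le> 1 \<Longrightarrow> 1 - \<delta> < norm h \<Longrightarrow> norm (w - h) < \<epsilon>"
proof -
  have "0 < (INF (x, y)\<in>{(x :: 'a cdual, y). norm x = 1 \<and> norm y \<ge> \<epsilon>}.
      ereal ((SUP \<theta>\<in>{0..2 * pi}. norm (x + cis \<theta> *\<^sub>C y)) - 1))"
    using complex_convex assms unfolding uniformly_complex_convex_def by blast
  then obtain \<eta> where \<eta>: "0 < ereal \<eta>" "ereal \<eta> <
      (INF (x, y)\<in>{(x :: 'a cdual, y). norm x = 1 \<and> norm y \<ge> \<epsilon>}.
      ereal ((SUP \<theta>\<in>{0..2 * pi}. norm (x + cis \<theta> *\<^sub>C y)) - 1))"
    using ereal_dense2 by blast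
  have sup: "1 + \<eta> < (SUP \<theta>\<in>{0..2 * pi}. norm (x + cis \<theta> *\<^sub>C y))"
    if "norm x = 1" "\<epsilon> \<le> norm y" for x y :: "'a cdual"
  proof -
    have "ereal \<eta> < ereal ((SUP \<theta>\<in>{0..2 * pi}. norm (x + cis \<theta> *\<^sub>C y)) - 1)"
      using \<eta>(2) by (rule less_le_trans) (rule INF_lower2[of "(x, y)"], use that in auto)
    then show ?thesis by simp
  qed
  \<comment> \<open>Chosen so that \<open>1 - \<delta> = 1 / (1 + \<eta>)\<close>.\<close>
  define \<delta> where "\<delta> = \<eta> / (1 + \<eta>)"
  have \<eta>0: "\<eta> > 0" using \<eta>(1) by simp
  show ?thesis
  proof
    show "\<delta> > 0" using \<eta>0 by (simp add: \<delta>_def)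
    fix h w :: "'a cdual"
    assume hw: "damping h w" "norm w \<le> 1" "1 - \<delta> < norm h"
    show "norm (w - h) < \<epsilon>"
    proof (rule ccontr)
      assume far: "\<not> norm (w - h) < \<epsilon>"
      define c where "c = norm h"
      have "1 < (1 + \<eta>) * c" "0 < c"
      proof -
        have "1 - \<delta> = 1 / (1 + \<eta>)" using \<eta>0 by (simp add: \<delta>_def field_simps)
        then have *: "1 / (1 + \<eta>) < c" using hw(3) by (simp add: c_def)
        then show "1 < (1 + \<eta>) * c" using \<eta>0 by (simp add: field_simps)
        have "0 < 1 / (1 + \<eta>)" using \<eta>0 by simp
        with * show "0 < c" by linarith
      qed
      have "c \<le> 1"
      proof -
        have "norm h \<le> norm w"
          using hw(1) by (rule damping_norm_le)
        with hw(2) show ?thesis by (simp add: c_def)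
      qed
      have "(SUP \<theta>\<in>{0..2 * pi}. norm (h /\<^sub>R c + cis \<theta> *\<^sub>C ((w - h) /\<^sub>R c))) \<le> 1 / c"
      proof (rule cSUP_least)
        show "{0..2 * pi} \<noteq> {}" by simp
        fix \<theta>
        have "h /\<^sub>R c + cis \<theta> *\<^sub>C ((w - h) /\<^sub>R c) = (h + cis \<theta> *\<^sub>C (w - h)) /\<^sub>R c"
          by (simp only: linear_simps(5)[OF bounded_linear_scaleC_right] scaleR_add_right)
        then show "norm (h /\<^sub>R c + cis \<theta> *\<^sub>C ((w - h) /\<^sub>R c)) \<le> 1 / c"
          using order_trans[OF damping_rotation_le[OF hw(1), of \<theta>] hw(2)] \<open>0 < c\<close>
          by (simp add: divide_right_mono flip: divide_inverse_commute)
      qed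
      moreover have "\<epsilon> \<le> norm ((w - h) /\<^sub>R c)"
      proof -
        have "\<epsilon> * c \<le> \<epsilon> * 1" using \<open>c \<le> 1\<close> assms by (intro mult_left_mono) auto
        with far \<open>0 < c\<close> show ?thesis unfolding norm_scaleR by (simp add: field_simps)
      qed
      moreover have "norm (h /\<^sub>R c) = 1" using \<open>0 < c\<close> by (simp add: c_def)
      ultimately have "1 + \<eta> < 1 / c" using sup by fastforce
      with \<open>1 < (1 + \<eta>) * c\<close> \<open>0 < c\<close> show False by (simp add: field_simps)
    qed
  qed
qed

text \<open>At norm one both alternatives may apply and several lengths may serve; \<open>cutoff_unique\<close> shows that
  they all give the same functional.\<close>

definition is_cutoff :: "'a cdual \<Rightarrow> 'a cdual \<Rightarrow> bool"
  where "is_cutoff f z \<longleftrightarrow> (norm f \<le> 1 \<and> z = f) \<or> (norm z = 1 \<and> (\<exists>s. z = initial_part s f))"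

text \<open>Whichever functional is cut off at the smaller length \<open>s\<close>, the initial part of length \<open>s\<close> of the
  other one lies between: it is near the first image because taking initial parts is a
  contraction, and near the second by uniform monotonicity. A functional that stays whole counts
  as having infinite length.\<close>

lemma cutoffs_close:
  assumes "\<epsilon> > 0"
  shows "\<exists>\<delta>>0. \<forall>f g z w.
    is_cutoff f z \<longrightarrow> is_cutoff g w \<longrightarrow> norm (f - g) < \<delta> \<longrightarrow> norm (z - w) < \<epsilon>"
proof -
  obtain \<delta>0 where \<delta>0: "\<delta>0 > 0"
    "\<And>h w. damping h w \<Longrightarrow> norm w \<le> 1 \<Longrightarrow> 1 - \<delta>0 < norm h \<Longrightarrow> norm (w - h) < \<epsilon> / 2"
    using uniform_monotonicity[of "\<epsilon> / 2"] assms by auto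
  define \<delta> where "\<delta> = min \<delta>0 (\<epsilon> / 2)"
  \<comment> \<open>\<open>z\<close> is the image with the smaller length; \<open>w\<close> may be whole or an initial part.\<close>
  have shorter: "norm (z - w) < \<epsilon>"
    if z: "norm z = 1" "z = initial_part s f" and w: "norm w \<le> 1" "damping (initial_part s g) w"
      and fg: "norm (f - g) < \<delta>" for f g z w s
  proof -
    define u where "u = initial_part s g"
    have zu: "norm (z - u) < \<delta>"
      using initial_part_diff_le[of s f g] fg by (simp add: u_def z(2))
    have "1 - \<delta>0 < norm u"
      using norm_triangle_ineq2[of z u] zu z(1) by (simp add: \<delta>_def)
    then have "norm (w - u) < \<epsilon> / 2" using \<delta>0(2) w by (simp add: u_def)
    moreover have "norm (z - w) \<le> norm (z - u) + norm (w - u)"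
      using norm_triangle_ineq4[of "z - u" "w - u"] by simp
    ultimately show ?thesis using zu by (simp add: \<delta>_def)
  qed
  have "norm (z - w) < \<epsilon>" if zw: "is_cutoff f z" "is_cutoff g w" and fg: "norm (f - g) < \<delta>" for f g z w
  proof -
    have gf: "norm (g - f) < \<delta>" using fg by (simp add: norm_minus_commute)
    have wz: "norm (z - w) = norm (w - z)" by (rule norm_minus_commute)
    consider "z = f" "w = g" | s where "norm z = 1" "z = initial_part s f" "norm g \<le> 1" "w = g"
      | s where "norm f \<le> 1" "z = f" "norm w = 1" "w = initial_part s g"
      | s t where "norm z = 1" "z = initial_part s f" "norm w = 1" "w = initial_part t g"
      using zw unfolding is_cutoff_def by blast
    then show ?thesis
    proof cases
      case 1
      then show ?thesis using fg assms by (simp add: \<delta>_def)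
    next
      case 2
      then show ?thesis using shorter fg damping_initial_part by metis
    next
      case 3
      then show ?thesis unfolding wz using shorter gf damping_initial_part by metis
    next
      case (4 s t)
      show ?thesis
      proof (cases "s \<le> t")
        case True
        then show ?thesis
          using shorter[OF 4(1,2) _ _ fg] 4 damping_initial_parts by simp
      next
        case False
        then show ?thesis
          unfolding wz using shorter[OF 4(3,4) _ _ gf] 4 damping_initial_parts by simp
      qed
    qed
  qed
  moreover have "\<delta> > 0" using \<delta>0(1) assms by (simp add: \<delta>_def)
  ultimately show ?thesis by blast
qed

text \<open>Two cutoffs of the same functional are within every \<open>\<epsilon>\<close> of each other, because \<open>f\<close> is within
  every \<open>\<delta>\<close> of itself.\<close>

lemma cutoff_unique:
  assumes "is_cutoff f z" "is_cutoff f w" shows "z = w"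
proof -
  have "norm (z - w) < \<epsilon>" if \<epsilon>: "\<epsilon> > 0" for \<epsilon>
  proof -
    obtain \<delta> where "\<delta> > 0"
      "\<And>f g z w. is_cutoff f z \<Longrightarrow> is_cutoff g w \<Longrightarrow> norm (f - g) < \<delta> \<Longrightarrow> norm (z - w) < \<epsilon>"
      using cutoffs_close[OF \<epsilon>] by blast
    from this(2)[OF assms] this(1) show ?thesis by simp
  qed
  from this[of "norm (z - w)"] show ?thesis by auto
qed

text \<open>If \<open>norm f > 1\<close>, some initial part has norm at least one, and the intermediate value theorem applies
  to the norms of the initial parts.\<close>

lemma cutoff_exists: "\<exists>z. is_cutoff f z"
proof (cases "norm f \<le> 1")
  case True
  then show ?thesis by (auto simp: is_cutoff_def)
next
  case False
  then obtain N where N: "1 \<le> norm (initial_part (real N) f)"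
    using norm_le_if_initial_parts_le[of f 1] by (meson linear)
  have "\<exists>s\<ge>0. s \<le> real N \<and> norm (initial_part s f) = 1"
  proof (rule IVT')
    show "continuous_on {0..real N} (\<lambda>s. norm (initial_part s f))"
      by (rule continuous_on_subset[OF continuous_on_norm_initial_part]) auto
  qed (use N in \<open>simp_all add: initial_part_def\<close>)
  then show ?thesis by (auto simp: is_cutoff_def)
qed

definition cutoff :: "'a cdual \<Rightarrow> 'a cdual"
  where "cutoff f = (SOME z. is_cutoff f z)"

lemma cutoff_is_cutoff: "is_cutoff f (cutoff f)"
  unfolding cutoff_def using cutoff_exists by (rule someI_ex)

lemma cutoff_eqI: "is_cutoff f z \<Longrightarrow> cutoff f = z"
  using cutoff_is_cutoff by (rule cutoff_unique)

lemma norm_cutoff_le: "norm (cutoff f) \<le> 1"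
  using cutoff_is_cutoff[of f] by (auto simp: is_cutoff_def)

lemma cutoff_unit_ball: "norm f \<le> 1 \<Longrightarrow> cutoff f = f"
  by (rule cutoff_eqI) (simp add: is_cutoff_def)

lemma uniformly_continuous_cutoff: "uniformly_continuous_on UNIV cutoff"
  unfolding uniformly_continuous_on_def
proof (intro allI impI)
  fix \<epsilon> :: real assume "\<epsilon> > 0"
  then obtain \<delta> where "\<delta> > 0"
    "\<And>f g z w. is_cutoff f z \<Longrightarrow> is_cutoff g w \<Longrightarrow> norm (f - g) < \<delta> \<Longrightarrow> norm (z - w) < \<epsilon>"
    using cutoffs_close by metis
  then show "\<exists>\<delta>>0. \<forall>f\<in>UNIV. \<forall>g\<in>UNIV. dist g f < \<delta> \<longrightarrow> dist (cutoff g) (cutoff f) < \<epsilon>"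
    using cutoff_is_cutoff unfolding dist_norm by blast
qed

lemma initial_part_initial_part:
  assumes "s \<le> real N" shows "initial_part s (initial_part (real N) f) = initial_part s f"
proof (rule dual_eqI)
  fix j
  have "ramp s j * ramp (real N) j = ramp s j"
    using assms by (cases "j < N") (auto simp: ramp_def)
  then show "cdual_apply (initial_part s (initial_part (real N) f)) (e j)
      = cdual_apply (initial_part s f) (e j)"
    by (simp add: initial_part_basis flip: mult.assoc of_real_mult)
qed

lemma initial_part_initial_part_ge:
  assumes "real N \<le> s" shows "initial_part s (initial_part (real N) f) = initial_part (real N) f"
proof (rule dual_eqI)
  fix j
  have "ramp s j * ramp (real N) j = ramp (real N) j"
    using assms by (cases "j < N") (auto simp: ramp_def)
  then show "cdual_apply (initial_part s (initial_part (real N) f)) (e j)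
      = cdual_apply (initial_part (real N) f) (e j)"
    by (simp add: initial_part_basis flip: mult.assoc of_real_mult)
qed

text \<open>Let \<open>p\<close> consist of the first \<open>n + 1\<close> coordinates of \<open>f\<close>. Up to length \<open>n + 1\<close> the initial parts of \<open>f\<close>
  and \<open>p\<close> coincide, so if one of them has norm one, it is the cutoff of both, by uniqueness.
  Otherwise neither functional is cut off before its coordinate \<open>n\<close> has been kept unchanged.\<close>

lemma cutoff_local:
  "cdual_apply (cutoff f) (e n) = cdual_apply (cutoff (initial_part (real (Suc n)) f)) (e n)"
proof -
  define p where "p = initial_part (real (Suc n)) f"
  have p_n: "cdual_apply p (e n) = cdual_apply f (e n)"
    by (simp add: p_def initial_part_basis ramp_def)
  have short: "cutoff f = cutoff p" if "norm (initial_part s f) = 1" "s \<le> real (Suc n)" for s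
  proof -
    have "is_cutoff f (initial_part s f)" using that(1) by (auto simp: is_cutoff_def)
    moreover have "initial_part s p = initial_part s f"
      unfolding p_def using that(2) by (rule initial_part_initial_part)
    then have "is_cutoff p (initial_part s f)"
      using that(1) by (metis is_cutoff_def)
    ultimately show ?thesis by (simp add: cutoff_eqI)
  qed
  consider s where "norm (initial_part s f) = 1" "s \<le> real (Suc n)"
    | "cutoff p = p" "cdual_apply (cutoff f) (e n) = cdual_apply f (e n)"
  proof (cases "norm p \<le> 1")
    case True
    consider "cutoff f = f" | s where "norm (cutoff f) = 1" "cutoff f = initial_part s f"
      using cutoff_is_cutoff[of f] by (auto simp: is_cutoff_def)
    then show ?thesis
    proof cases
      case 1
      with True show ?thesis by (intro that(2)) (auto simp: cutoff_unit_ball)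
    next
      case (2 s)
      show ?thesis
      proof (cases "s \<le> real (Suc n)")
        case False
        then have "ramp s n = 1" by (simp add: ramp_def)
        with True 2 show ?thesis
          by (intro that(2)) (auto simp: cutoff_unit_ball initial_part_basis)
      qed (use 2 that(1) in metis)
    qed
  next
    case False
    then obtain s where s: "norm (initial_part s p) = 1"
      using cutoff_is_cutoff[of p] by (auto simp: is_cutoff_def)
    have "s \<le> real (Suc n)"
    proof (rule ccontr)
      assume "\<not> s \<le> real (Suc n)"
      then have "initial_part s p = p"
        unfolding p_def by (intro initial_part_initial_part_ge) simp
      with s False show False by simp
    qed
    then show ?thesis
      using that(1)[of s] s unfolding p_def by (simp only: initial_part_initial_part)
  qed
  then show ?thesis
    unfolding p_def[symmetric] by cases (simp_all add: short p_n)
qed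

end


section \<open>Weak-star continuity\<close>

lemma continuous_map_weak_star_eval:
  fixes x :: "'a::complex_normed_vector"
  shows "continuous_map weak_star euclidean (\<lambda>f. cdual_apply f x)"
proof -
  have "continuous_map (weak_star :: 'a cdual topology)
      (product_topology (\<lambda>_. euclidean) UNIV) cdual_apply"
    unfolding weak_star_def
    using continuous_map_pullback[OF continuous_map_id] by (simp add: o_def)
  then show ?thesis
    by (simp add: continuous_map_componentwise_UNIV)
qed

text \<open>The defining property of an initial topology.\<close>

lemma continuous_map_into_weak_star:
  assumes "\<And>x. continuous_map X euclidean (\<lambda>p. cdual_apply (r p) x)"
  shows "continuous_map X weak_star r"
  unfolding weak_star_def
  by (rule continuous_map_pullback') (use assms in \<open>simp_all add: continuous_map_componentwise_UNIV o_def\<close>)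

context complex_convex_dual_basis
begin

text \<open>At a basis vector, the value of the cutoff factors through an initial part, hence through finitely
  many evaluations. The cutoffs are contractive functionals, so convergence of the partial sums of
  \<open>x\<close> carries over to their values uniformly in \<open>f\<close>.\<close>

lemma weak_star_continuous_cutoff: "continuous_map weak_star weak_star cutoff"
proof (rule continuous_map_into_weak_star)
  have basis: "continuous_map weak_star euclidean (\<lambda>f. cdual_apply (cutoff f) (e n))" for n
  proof -
    have "continuous_map weak_star euclidean (initial_part (real (Suc n)))"
      unfolding initial_part_def
      by (intro continuous_map_sum continuous_map_compose[OF continuous_map_weak_star_eval,
            where g = "\<lambda>c. (of_real _ * c) *\<^sub>C _", unfolded o_def])
         (auto intro!: continuous_intros bounded_linear.continuous_on[OF bounded_linear_scaleC_left])
    moreover have "continuous_on UNIV (\<lambda>g. cdual_apply (cutoff g) (e n))"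
      by (intro bounded_linear.continuous_on[OF bounded_linear_cdual_eval]
          uniformly_continuous_imp_continuous uniformly_continuous_cutoff)
    ultimately have "continuous_map weak_star euclidean
        ((\<lambda>g. cdual_apply (cutoff g) (e n)) \<circ> initial_part (real (Suc n)))"
      by (intro continuous_map_compose) auto
    then show ?thesis by (simp only: o_def cutoff_local[symmetric])
  qed
  fix x
  let ?S = "\<lambda>N. \<Sum>j<N. coord x j *\<^sub>C e j"
  have "?S \<longlonglongrightarrow> x" using coord_sums[of x] by (simp add: sums_def)
  have "continuous_map weak_star Met_TC.mtopology (\<lambda>f. cdual_apply (cutoff f) x)"
  proof (rule Met_TC.continuous_map_uniform_limit)
    have "continuous_map weak_star euclidean (\<lambda>f. coord x j * cdual_apply (cutoff f) (e j))" for j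
      using continuous_map_compose[OF basis, of _ "\<lambda>c. coord x j * c"]
      by (simp add: o_def continuous_on_mult_left)
    then have "continuous_map weak_star euclidean (\<lambda>f. cdual_apply (cutoff f) (?S N))" for N
      unfolding cdual_apply_simps by (intro continuous_map_sum) auto
    then show "\<forall>\<^sub>F N in sequentially.
        continuous_map weak_star Met_TC.mtopology (\<lambda>f. cdual_apply (cutoff f) (?S N))"
      by simp
    fix \<epsilon> :: real assume "0 < \<epsilon>"
    then have "\<forall>\<^sub>F N in sequentially. dist (?S N) x < \<epsilon>"
      using \<open>?S \<longlonglongrightarrow> x\<close> by (intro tendstoD)
    then show "\<forall>\<^sub>F N in sequentially. \<forall>f\<in>topspace weak_star. cdual_apply (cutoff f) x \<in> UNIV \<and>
        dist (cdual_apply (cutoff f) (?S N)) (cdual_apply (cutoff f) x) < \<epsilon>"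
    proof (rule eventually_mono, intro ballI conjI UNIV_I)
      fix N f assume *: "dist (?S N) x < \<epsilon>"
      have "dist (cdual_apply (cutoff f) (?S N)) (cdual_apply (cutoff f) x)
          \<le> norm (cutoff f) * norm (?S N - x)"
        using cdual_apply_le[of "cutoff f" "?S N - x"]
        by (simp add: dist_norm linear_simps[OF bounded_linear_cdual_apply])
      also have "\<dots> \<le> 1 * norm (?S N - x)"
        by (intro mult_right_mono norm_cutoff_le) simp
      finally show "dist (cdual_apply (cutoff f) (?S N)) (cdual_apply (cutoff f) x) < \<epsilon>"
        using * by (simp add: dist_norm)
    qed
  qed simp
  then show "continuous_map weak_star euclidean (\<lambda>f. cdual_apply (cutoff f) x)"
    by simp
qed

end

theorem corollary2p3:
  fixes e :: "nat \<Rightarrow> 'a::complex_banach"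
  assumes "unconditional_schauder_basis e"
    and "\<forall>j. norm (e j) = 1"
    and "unconditional_basis_constant e = 1"
    and "uniformly_complex_convex TYPE('a cdual)"
  shows "dual_admits_uniformly_simultaneously_continuous_retraction TYPE('a)"
proof -
  \<comment> \<open>The constant is an infimum, so domination holds with every factor above one, and in the limit
    with the factor one itself.\<close>
  have "norm (\<Sum>j<N. a j *\<^sub>C e j) \<le> norm (\<Sum>j<N. b j *\<^sub>C e j)"
    if ab: "\<And>j. j < N \<Longrightarrow> cmod (a j) \<le> cmod (b j)" for N and a b :: "nat \<Rightarrow> complex"
  proof (rule field_le_epsilon)
    fix \<epsilon> :: real assume "\<epsilon> > 0"
    let ?B = "norm (\<Sum>j<N. b j *\<^sub>C e j)"
    \<comment> \<open>The \<open>1\<close> in the denominator keeps it positive when \<open>?B = 0\<close>.\<close>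
    have "unconditional_basis_constant e < ereal (1 + \<epsilon> / (1 + ?B))"
      using \<open>\<epsilon> > 0\<close> by (simp add: assms(3) one_ereal_def add_pos_nonneg)
    then obtain K where K: "K < 1 + \<epsilon> / (1 + ?B)"
      "norm (\<Sum>j<N. a j *\<^sub>C e j) \<le> K * ?B"
      unfolding unconditional_basis_constant_def Inf_less_iff using ab by auto
    have "K * ?B \<le> (1 + \<epsilon> / (1 + ?B)) * ?B"
      using K(1) by (intro mult_right_mono) auto
    also have "\<dots> = ?B + \<epsilon> * (?B / (1 + ?B))" by (simp add: algebra_simps)
    also have "\<dots> \<le> ?B + \<epsilon> * 1"
      using \<open>\<epsilon> > 0\<close> by (intro add_left_mono mult_left_mono) (auto simp: divide_simps add_pos_nonneg)
    finally show "norm (\<Sum>j<N. a j *\<^sub>C e j) \<le> ?B + \<epsilon>" using K(2) by simp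
  qed
  then interpret complex_convex_dual_basis e
    using assms by unfold_locales (auto simp: unconditional_schauder_basis_def)
  show ?thesis
    unfolding dual_admits_uniformly_simultaneously_continuous_retraction_def
  proof (intro exI conjI)
    show "continuous_map weak_star (subtopology weak_star (cball 0 1)) cutoff"
      using weak_star_continuous_cutoff norm_cutoff_le
      by (auto simp: continuous_map_in_subtopology)
  qed (use norm_cutoff_le cutoff_unit_ball uniformly_continuous_cutoff in auto)
qed

end
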